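(* Let $E\subset\mathbb{R}^n$ be closed. Then every Almgren competitor $F$ of $E$ is a topological competitor of $E$ of dimension $d$, for any integer $d$ with $0<d<n$.
   Context: Almgren competitor. An Almgren competitor of a closed set $E\subset\mathbb{R}^n$ is a closed set $F\subset\mathbb{R}^n$ that can be written $F=\varphi(E)$, where $\varphi:\mathbb{R}^n\to\mathbb{R}^n$ is a Lipschitz map for which there exists a compact ball $B\subset\mathbb{R}^n$ with $\varphi|_{\mathbb{R}^n\setminus B}=\mathrm{id}$ and $\varphi(B)\subset B$. Topological competitor. $H_k(X;\mathbb{Z})$ denotes singular homology with integer coefficients. A Euclidean $k$-sphere in $\mathbb{R}^n$ is a round sphere lying in a $(k+1)$-dimensional affine subspace (two distinct points if $k=0$); it represents a homology class via its fundamental cycle (for $k=0$ and $S=\{a,b\}$, the class of $b-a$). A closed set $F\subset\mathbb{R}^n$ is a topological competitor of dimension $d$ of the closed set $E$ if there is a ball $B\subset\mathbb{R}^n$ such that (1) $F\setminus B=E\setminus B$; (2) for each Euclidean $(n-d-1)$-sphere $S\subset\mathbb{R}^n\setminus(B\cup E)$, if $S$ represents a non-zero element of $H_{n-d-1}(\mathbb{R}^n\setminus E;\mathbb{Z})$, then it also represents a non-zero element of $H_{n-d-1}(\mathbb{R}^n\setminus F;\mathbb{Z})$. *)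

theory Defs
  imports "HOL-Analysis.Analysis" "HOL-Homology.Homology"
begin

definition almgren_competitor :: "(real ^ 'n) set \<Rightarrow> (real ^ 'n) set \<Rightarrow> bool" where
  "almgren_competitor E F \<longleftrightarrow>
     closed E \<and> closed F \<and>
     (\<exists>\<phi>. F = \<phi> ` E \<and> (\<exists>L. L-lipschitz_on UNIV \<phi>) \<and>
        (\<exists>c r. 0 < r \<and> (\<forall>x. x \<notin> cball c r \<longrightarrow> \<phi> x = x) \<and> \<phi> ` cball c r \<subseteq> cball c r))"

definition euclidean_sphere :: "nat \<Rightarrow> (real ^ 'n) set \<Rightarrow> bool" where
  "euclidean_sphere k S \<longleftrightarrow>
     (\<exists>A c r. affine A \<and> aff_dim A = int k + 1 \<and> c \<in> A \<and> 0 < r \<and> S = sphere c r \<inter> A)"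

text \<open>A \<open>0\<close>-simplex is a function on the one-point set \<open>standard_simplex 0\<close>,
  made extensional as \<open>singular_simplex\<close> requires.\<close>

definition point_chain :: "'a \<Rightarrow> 'a chain" where
  "point_chain a = frag_of (\<lambda>t\<in>standard_simplex 0. a)"

text \<open>For \<open>k > 0\<close>, a fundamental cycle of a \<open>k\<close>-sphere \<open>S\<close> is a singular cycle in \<open>S\<close> whose class
  generates \<open>H_k(S; Z)\<close>, which is infinite cyclic; so the class is determined up to sign, that is,
  up to the choice of an orientation.\<close>

definition fundamental_cycle :: "nat \<Rightarrow> 'a::topological_space set \<Rightarrow> 'a chain \<Rightarrow> bool" where
  "fundamental_cycle k S z \<longleftrightarrow>
     (if k = 0
      then \<exists>a b. a \<noteq> b \<and> S = {a, b} \<and> z = point_chain b - point_chain a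
      else singular_relcycle k (top_of_set S) {} z \<and>
           generate (homology_group (int k) (top_of_set S))
             {homologous_rel_set k (top_of_set S) {} z}
           = carrier (homology_group (int k) (top_of_set S)))"

text \<open>Used for \<open>S \<subseteq> X\<close>, where a cycle in \<open>S\<close> is also a cycle in \<open>X\<close>. The choice of the fundamental
  cycle is irrelevant, see \<open>represents_nonzero_iff\<close> below.\<close>

definition represents_nonzero :: "nat \<Rightarrow> 'a::topological_space set \<Rightarrow> 'a set \<Rightarrow> bool" where
  "represents_nonzero k S X \<longleftrightarrow>
     (\<exists>z. fundamental_cycle k S z \<and>
        homologous_rel_set k (top_of_set X) {} z \<noteq> \<one>\<^bsub>homology_group (int k) (top_of_set X)\<^esub>)"

text \<open>The ball is taken closed. An open ball would give the same notion: enlarging a closed ball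
  to an open one, or an open ball to its closure, preserves both conditions.
  The dimension is only meant to be \<open>d < n\<close>, so the subtraction does not truncate.\<close>

definition topological_competitor :: "nat \<Rightarrow> (real ^ 'n) set \<Rightarrow> (real ^ 'n) set \<Rightarrow> bool" where
  "topological_competitor d E F \<longleftrightarrow>
     closed E \<and> closed F \<and>
     (\<exists>c r. 0 < r \<and> F - cball c r = E - cball c r \<and>
        (\<forall>S. euclidean_sphere (CARD('n) - d - 1) S \<and> S \<subseteq> - (cball c r \<union> E) \<and>
             represents_nonzero (CARD('n) - d - 1) S (- E) \<longrightarrow>
             represents_nonzero (CARD('n) - d - 1) S (- F)))"

lemma fundamental_cycle_class_nonzero:
  assumes z: "fundamental_cycle k S z" and w: "fundamental_cycle k S w" and "S \<subseteq> X"
    and nz: "homologous_rel_set k (top_of_set X) {} z \<noteq> \<one>\<^bsub>homology_group (int k) (top_of_set X)\<^esub>"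
  shows "homologous_rel_set k (top_of_set X) {} w \<noteq> \<one>\<^bsub>homology_group (int k) (top_of_set X)\<^esub>"
proof (cases "k = 0")
  case True
  then have wz: "w = z \<or> w = - z"
    using z w by (auto simp: fundamental_cycle_def doubleton_eq_iff)
  have one: "\<one>\<^bsub>homology_group (int k) (top_of_set X)\<^esub> = singular_relboundary_set k (top_of_set X) {}"
    by simp
  show ?thesis
    using wz nz unfolding one homologous_rel_set_eq_relboundary
    by (auto simp: singular_relboundary_minus)
next
  case False
  define G where "G = homology_group (int k) (top_of_set S)"
  define H where "H = homology_group (int k) (top_of_set X)"
  define h where "h = hom_induced (int k) (top_of_set S) {} (top_of_set X) {} id"
  let ?cS = "\<lambda>z. homologous_rel_set k (top_of_set S) {} z"
  let ?cX = "\<lambda>z. homologous_rel_set k (top_of_set X) {} z"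
  have cyc: "singular_relcycle k (top_of_set S) {} z" "singular_relcycle k (top_of_set S) {} w"
    and gen: "generate G {?cS z} = carrier G" "generate G {?cS w} = carrier G"
    using z w False by (auto simp: fundamental_cycle_def G_def)
  have cont: "continuous_map (top_of_set S) (top_of_set X) id"
    using \<open>S \<subseteq> X\<close> by (auto simp: continuous_on_id)
  have chain: "h (?cS v) = ?cX v" if "singular_relcycle k (top_of_set S) {} v" for v
  proof -
    have "chain_map k id v = v"
      using that chain_map_id_gen singular_relcycle_def by (metis id_apply)
    then show ?thesis
      using hom_induced_chain_map [OF cont _ that, of "{}"] by (simp add: h_def)
  qed
  interpret group_hom G H h
    by (simp add: group_hom_def group_hom_axioms_def G_def H_def h_def hom_induced_hom)
  have car: "?cS w \<in> carrier G" "?cS z \<in> carrier G"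
    using gen generate.incl by (metis singletonI)+
  show ?thesis
  proof
    assume "?cX w = \<one>\<^bsub>homology_group (int k) (top_of_set X)\<^esub>"
    then have hw: "h (?cS w) = \<one>\<^bsub>H\<^esub>"
      using chain [OF cyc(2)] by (simp add: H_def)
    have "?cS w \<in> kernel G H h"
      using car hw by (simp add: kernel_def)
    then have "generate G {?cS w} \<subseteq> kernel G H h"
      by (intro G.generate_subgroup_incl subgroup_kernel) auto
    then have "h (?cS z) = \<one>\<^bsub>H\<^esub>"
      using car gen by (auto simp: kernel_def)
    then show False
      using nz chain [OF cyc(1)] by (simp add: H_def)
  qed
qed

lemma represents_nonzero_iff:
  assumes "fundamental_cycle k S z" "S \<subseteq> X"
  shows "represents_nonzero k S X \<longleftrightarrow>
    homologous_rel_set k (top_of_set X) {} z \<noteq> \<one>\<^bsub>homology_group (int k) (top_of_set X)\<^esub>"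
  using assms fundamental_cycle_class_nonzero unfolding represents_nonzero_def by blast

end

theory Submission
  imports Defs
begin

text \<open>Let \<open>F = \<phi> ` E\<close>, let \<open>B\<close> be the ball outside which \<open>\<phi>\<close> is the identity, and put \<open>A = B \<union> E\<close>. A sphere
  \<open>S\<close> disjoint from \<open>A\<close> has a reduced homology class \<open>c\<close> in the complement of \<open>A\<close>, and the claim is: if
  \<open>c\<close> dies in the complement of \<open>F\<close>, then it dies in the complement of \<open>E\<close>. Intuitively one
  pulls back under \<open>\<phi>\<close> a chain that avoids \<open>F\<close> and is bounded by \<open>S\<close>. A transversal preimage is avoided
  by doubling the dimension: the map \<open>\<phi>\<close> itself does not send the complement of \<open>E\<close> to that of \<open>F\<close>,
  but its graph lives in \<open>V \<times> V\<close>, where \<open>V\<close> is the ambient space, and there a genuine map in the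
  opposite direction exists.

  The complement of \<open>Z \<times> {0}\<close> in \<open>V \<times> V\<close> is an iterated suspension of the complement of \<open>Z\<close> in \<open>V\<close>.
  Hence \<open>c\<close> yields one class \<open>c'\<close> in the complement of \<open>A \<times> {0}\<close> such that, for every closed \<open>Z \<subseteq> A\<close>
  at once, \<open>c\<close> dies in the complement of \<open>Z\<close> iff \<open>c'\<close> dies in the complement of \<open>Z \<times> {0}\<close>
  (\<open>suspension_to_product\<close>).

  It remains to find a map \<open>f\<close> from the complement of \<open>F \<times> {0}\<close> to the complement of \<open>E \<times> {0}\<close> whose
  restriction to the complement of \<open>A \<times> {0}\<close> is homotopic to the inclusion
  (\<open>vanishing_pulls_back_product\<close>). The map \<open>(y, v) \<mapsto> (y + v, \<phi> (y + v) - y)\<close> hits \<open>E \<times> {0}\<close> only where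
  \<open>y = \<phi> x\<close> and \<open>v = x - \<phi> x\<close> for a point \<open>x\<close> of \<open>E\<close>; then \<open>y\<close> lies in \<open>F\<close> and \<open>v\<close> is no longer than the maximal
  displacement \<open>R\<close> of \<open>\<phi>\<close>. So \<open>f\<close> first stretches \<open>v\<close> to have length above \<open>R\<close> over the points of \<open>F\<close>.
  The homotopy to the inclusion exists because \<open>\<phi>\<close> is homotopic to the identity
  on \<open>A\<close> along segments that stay in \<open>A\<close>.\<close>

section \<open>Homology classes that vanish in a larger space\<close>

abbreviation push ::
  "int \<Rightarrow> 'a::topological_space set \<Rightarrow> 'b::topological_space set \<Rightarrow> ('a \<Rightarrow> 'b) \<Rightarrow> 'a chain set \<Rightarrow> 'b chain set"
  where "push q X Y f \<equiv> hom_induced q (top_of_set X) {} (top_of_set Y) {} f"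

abbreviation vanishes_in :: "int \<Rightarrow> 'a::topological_space set \<Rightarrow> 'a set \<Rightarrow> 'a chain set \<Rightarrow> bool"
  where "vanishes_in q X Y c \<equiv> push q X Y id c = \<one>\<^bsub>homology_group q (top_of_set Y)\<^esub>"

lemma push_one: "push q X Y f \<one>\<^bsub>homology_group q (top_of_set X)\<^esub> = \<one>\<^bsub>homology_group q (top_of_set Y)\<^esub>"
  by (meson group_relative_homology_group hom_induced_empty_hom hom_one)

lemma push_push:
  assumes "continuous_on X f" "f \<in> X \<rightarrow> Y" "continuous_on Y g" "g \<in> Y \<rightarrow> Z"
  shows "push q Y Z g (push q X Y f c) = push q X Z (g \<circ> f) c"
  using assms by (subst hom_induced_compose') auto

lemma iso_eq_one_iff:
  assumes "h \<in> iso G H" "group G" "group H" "x \<in> carrier G"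
  shows "h x = \<one>\<^bsub>H\<^esub> \<longleftrightarrow> x = \<one>\<^bsub>G\<^esub>"
proof -
  interpret group_hom G H h
    using assms by (simp add: group_hom_def group_hom_axioms_def iso_def)
  have "inj_on h (carrier G)"
    using assms by (simp add: iso_def bij_betw_def)
  then show ?thesis
    using assms by (metis G.one_closed hom_one inj_onD)
qed

lemma iso_preimage:
  assumes "h \<in> iso G H" "y \<in> carrier H"
  obtains x where "x \<in> carrier G" "h x = y"
proof -
  have "y \<in> h ` carrier G"
    using assms by (simp add: iso_def bij_betw_def)
  then show ?thesis
    by (rule imageE) (use that in simp)
qed

section \<open>The Mayer-Vietoris isomorphism for a contractible cover\<close>

text \<open>For open contractible \<open>P\<close> and \<open>Q\<close> that meet, this is the graph of the Mayer-Vietoris isomorphism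
  \<open>H_q (P \<inter> Q) \<cong> H_(q+1) (P \<union> Q)\<close> of reduced homology, given by the zigzag
  \<open>H_q (P \<inter> Q) \<leftarrow> H_(q+1) (P, P \<inter> Q) \<rightarrow> H_(q+1) (P \<union> Q, Q) \<leftarrow> H_(q+1) (P \<union> Q)\<close>.
  As a relation it is natural in \<open>P\<close> and \<open>Q\<close> without inverting any map.\<close>

definition mv_related :: "int \<Rightarrow> 'a::topological_space set \<Rightarrow> 'a set \<Rightarrow> 'a chain set \<Rightarrow> 'a chain set \<Rightarrow> bool"
  where "mv_related q P Q c c' \<longleftrightarrow>
     c' \<in> carrier (reduced_homology_group (q + 1) (top_of_set (P \<union> Q))) \<and>
     (\<exists>e \<in> carrier (relative_homology_group (q + 1) (top_of_set P) (P \<inter> Q)).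
        hom_boundary (q + 1) (top_of_set P) (P \<inter> Q) e = c \<and>
        hom_induced (q + 1) (top_of_set P) (P \<inter> Q) (top_of_set (P \<union> Q)) Q id e =
        hom_induced (q + 1) (top_of_set (P \<union> Q)) {} (top_of_set (P \<union> Q)) Q id c')"

text \<open>Excision of \<open>Q - P\<close>, which is closed in \<open>P \<union> Q\<close> and contained in its open subset \<open>Q\<close>.\<close>

lemma iso_excision_open_cover:
  assumes "open P" "open Q"
  shows "hom_induced p (top_of_set P) (P \<inter> Q) (top_of_set (P \<union> Q)) Q id
         \<in> iso (relative_homology_group p (top_of_set P) (P \<inter> Q))
               (relative_homology_group p (top_of_set (P \<union> Q)) Q)"
proof -
  let ?X = "top_of_set (P \<union> Q)"
  have "closedin ?X (Q - P)"
    using \<open>open P\<close> by (auto simp: closedin_closed intro!: exI [of _ "- P"])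
  moreover have "openin ?X Q"
    using \<open>open Q\<close> by (auto simp: openin_open)
  ultimately have "?X closure_of (Q - P) \<subseteq> ?X interior_of Q"
    by (simp add: closure_of_closedin interior_of_openin)
  from homology_excision_axiom [OF this, of "P \<union> Q" p]
  have "hom_induced p (subtopology ?X ((P \<union> Q) - (Q - P))) (Q - (Q - P)) (subtopology ?X (P \<union> Q)) Q id
    \<in> iso (relative_homology_group p (subtopology ?X ((P \<union> Q) - (Q - P))) (Q - (Q - P)))
          (relative_homology_group p (subtopology ?X (P \<union> Q)) Q)"
    by simp
  moreover have "(P \<union> Q) - (Q - P) = P" "Q - (Q - P) = P \<inter> Q"
    by auto
  ultimately show ?thesis
    by (simp add: subtopology_subtopology Int_absorb1)
qed

lemma iso_boundary_contractible_cover: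
  assumes "contractible P" "P \<inter> Q \<noteq> {}"
  shows "hom_boundary (q + 1) (top_of_set P) (P \<inter> Q)
         \<in> iso (relative_homology_group (q + 1) (top_of_set P) (P \<inter> Q))
               (reduced_homology_group q (top_of_set (P \<inter> Q)))"
  using iso_relative_homology_of_contractible [of "top_of_set P" "P \<inter> Q" "q + 1"] assms
  by (simp add: subtopology_subtopology Int_absorb1)

lemma iso_relativization_contractible_cover:
  assumes "contractible Q" "P \<inter> Q \<noteq> {}"
  shows "hom_induced q (top_of_set (P \<union> Q)) {} (top_of_set (P \<union> Q)) Q id
         \<in> iso (reduced_homology_group q (top_of_set (P \<union> Q)))
               (relative_homology_group q (top_of_set (P \<union> Q)) Q)"
  using iso_reduced_homology_by_contractible [of "top_of_set (P \<union> Q)" Q q] assms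
  by (simp add: subtopology_subtopology Int_absorb1 Int_commute) blast

lemma mv_related_exists:
  assumes "open P" "open Q" "contractible P" "contractible Q" "P \<inter> Q \<noteq> {}"
    and c: "c \<in> carrier (reduced_homology_group q (top_of_set (P \<inter> Q)))"
  obtains c' where "mv_related q P Q c c'"
proof -
  obtain e where e: "e \<in> carrier (relative_homology_group (q + 1) (top_of_set P) (P \<inter> Q))"
      "hom_boundary (q + 1) (top_of_set P) (P \<inter> Q) e = c"
    using iso_preimage [OF iso_boundary_contractible_cover [OF assms(3,5)] c] .
  let ?x = "hom_induced (q + 1) (top_of_set P) (P \<inter> Q) (top_of_set (P \<union> Q)) Q id e"
  have "?x \<in> carrier (relative_homology_group (q + 1) (top_of_set (P \<union> Q)) Q)"
    by (rule hom_induced_carrier)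
  then obtain c' where "c' \<in> carrier (reduced_homology_group (q + 1) (top_of_set (P \<union> Q)))"
      "?x = hom_induced (q + 1) (top_of_set (P \<union> Q)) {} (top_of_set (P \<union> Q)) Q id c'"
    by (rule iso_preimage [OF iso_relativization_contractible_cover [OF assms(4,5)]]) (metis that)
  with e have "mv_related q P Q c c'"
    unfolding mv_related_def by (intro conjI bexI [of _ e])
  then show ?thesis
    by (rule that)
qed

lemma mv_related_eq_one_iff:
  assumes "open P" "open Q" "contractible P" "contractible Q" "P \<inter> Q \<noteq> {}"
    and "mv_related q P Q c c'"
  shows "c = \<one>\<^bsub>homology_group q (top_of_set (P \<inter> Q))\<^esub> \<longleftrightarrow>
         c' = \<one>\<^bsub>homology_group (q + 1) (top_of_set (P \<union> Q))\<^esub>"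
proof -
  obtain e where e: "e \<in> carrier (relative_homology_group (q + 1) (top_of_set P) (P \<inter> Q))"
      "hom_boundary (q + 1) (top_of_set P) (P \<inter> Q) e = c"
      "hom_induced (q + 1) (top_of_set P) (P \<inter> Q) (top_of_set (P \<union> Q)) Q id e =
        hom_induced (q + 1) (top_of_set (P \<union> Q)) {} (top_of_set (P \<union> Q)) Q id c'"
    and c': "c' \<in> carrier (reduced_homology_group (q + 1) (top_of_set (P \<union> Q)))"
    using assms(6) by (auto simp: mv_related_def)
  have "c = \<one>\<^bsub>homology_group q (top_of_set (P \<inter> Q))\<^esub> \<longleftrightarrow>
      e = \<one>\<^bsub>relative_homology_group (q + 1) (top_of_set P) (P \<inter> Q)\<^esub>"
    using iso_eq_one_iff [OF iso_boundary_contractible_cover [OF assms(3,5)] group_relative_homology_group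
        group_reduced_homology_group e(1)]
    unfolding e(2) one_reduced_homology_group .
  also have "\<dots> \<longleftrightarrow> hom_induced (q + 1) (top_of_set (P \<union> Q)) {} (top_of_set (P \<union> Q)) Q id c'
      = \<one>\<^bsub>relative_homology_group (q + 1) (top_of_set (P \<union> Q)) Q\<^esub>"
    using iso_eq_one_iff [OF iso_excision_open_cover [OF assms(1,2)] group_relative_homology_group
        group_relative_homology_group e(1)]
    unfolding e(3) by (rule sym)
  also have "\<dots> \<longleftrightarrow> c' = \<one>\<^bsub>homology_group (q + 1) (top_of_set (P \<union> Q))\<^esub>"
    using iso_eq_one_iff [OF iso_relativization_contractible_cover [OF assms(4,5)]
        group_reduced_homology_group group_relative_homology_group c']
    unfolding one_reduced_homology_group .
  finally show ?thesis .
qed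

lemma mv_related_mono:
  assumes "mv_related q P Q c c'" "P \<subseteq> P'" "Q \<subseteq> Q'"
  shows "mv_related q P' Q' (push q (P \<inter> Q) (P' \<inter> Q') id c)
           (push (q + 1) (P \<union> Q) (P' \<union> Q') id c')"
proof -
  obtain e where e: "e \<in> carrier (relative_homology_group (q + 1) (top_of_set P) (P \<inter> Q))"
      "hom_boundary (q + 1) (top_of_set P) (P \<inter> Q) e = c"
      "hom_induced (q + 1) (top_of_set P) (P \<inter> Q) (top_of_set (P \<union> Q)) Q id e =
        hom_induced (q + 1) (top_of_set (P \<union> Q)) {} (top_of_set (P \<union> Q)) Q id c'"
    and c': "c' \<in> carrier (reduced_homology_group (q + 1) (top_of_set (P \<union> Q)))"
    using assms(1) by (auto simp: mv_related_def)
  define e' where "e' = hom_induced (q + 1) (top_of_set P) (P \<inter> Q) (top_of_set P') (P' \<inter> Q') id e"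
  have cP: "continuous_map (top_of_set P) (top_of_set P') id" "id \<in> P \<inter> Q \<rightarrow> P' \<inter> Q'"
    and cU: "continuous_map (top_of_set (P \<union> Q)) (top_of_set (P' \<union> Q')) id" "id \<in> Q \<rightarrow> Q'"
    and cPU: "continuous_map (top_of_set P) (top_of_set (P \<union> Q)) id" "id \<in> P \<inter> Q \<rightarrow> Q"
    and cPU': "continuous_map (top_of_set P') (top_of_set (P' \<union> Q')) id" "id \<in> P' \<inter> Q' \<rightarrow> Q'"
    using assms(2,3) by (auto intro: continuous_on_id)
  have 1: "hom_boundary (q + 1) (top_of_set P') (P' \<inter> Q') e' = push q (P \<inter> Q) (P' \<inter> Q') id c"
    using fun_cong [OF naturality_hom_induced [OF cP, of "q + 1"], of e] e(2)
    by (simp add: e'_def subtopology_subtopology Int_absorb1)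
  have "hom_induced (q + 1) (top_of_set P') (P' \<inter> Q') (top_of_set (P' \<union> Q')) Q' id e'
      = hom_induced (q + 1) (top_of_set P) (P \<inter> Q) (top_of_set (P' \<union> Q')) Q' (id \<circ> id) e"
    unfolding e'_def by (rule hom_induced_compose' [OF cP cPU'])
  also have "\<dots> = hom_induced (q + 1) (top_of_set (P \<union> Q)) Q (top_of_set (P' \<union> Q')) Q' id
       (hom_induced (q + 1) (top_of_set P) (P \<inter> Q) (top_of_set (P \<union> Q)) Q id e)"
    by (rule hom_induced_compose' [OF cPU cU, symmetric])
  also have "\<dots> = hom_induced (q + 1) (top_of_set (P \<union> Q)) {} (top_of_set (P' \<union> Q')) Q' (id \<circ> id) c'"
    unfolding e(3) by (rule hom_induced_compose' [OF _ _ cU]) auto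
  also have "\<dots> = hom_induced (q + 1) (top_of_set (P' \<union> Q')) {} (top_of_set (P' \<union> Q')) Q' id
       (push (q + 1) (P \<union> Q) (P' \<union> Q') id c')"
    by (rule hom_induced_compose' [OF cU(1), symmetric]) auto
  finally show ?thesis
    using 1 hom_induced_reduced [OF c'] hom_induced_carrier
    unfolding mv_related_def e'_def by blast
qed

section \<open>Complements and suspension\<close>

text \<open>If \<open>Z\<close> is invariant under translation along \<open>e\<close>, the sets \<open>off_half Z e\<close> and \<open>off_half Z (- e)\<close> are the
  two cones of a suspension: they are contractible, meet in the complement of \<open>Z\<close>, and cover the
  complement of the slice of \<open>Z\<close> by the hyperplane orthogonal to \<open>e\<close>.\<close>

definition off_half :: "'a::euclidean_space set \<Rightarrow> 'a \<Rightarrow> 'a set" where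
  "off_half Z e = - (Z \<inter> {x. e \<bullet> x \<le> 0})"

definition invariant_along :: "'a::euclidean_space set \<Rightarrow> 'a set \<Rightarrow> bool" where
  "invariant_along B Z \<longleftrightarrow> (\<forall>e\<in>B. \<forall>z\<in>Z. \<forall>t. z + t *\<^sub>R e \<in> Z)"

lemma open_off_half: "closed Z \<Longrightarrow> open (off_half Z e)"
  unfolding off_half_def by (intro open_Compl closed_Int closed_halfspace_le)

lemma off_half_Int: "off_half Z e \<inter> off_half Z (- e) = - Z"
  and off_half_Un: "off_half Z e \<union> off_half Z (- e) = - (Z \<inter> {x. e \<bullet> x = 0})"
  and off_half_antimono: "Z \<subseteq> A \<Longrightarrow> off_half A e \<subseteq> off_half Z e"
  by (auto simp: off_half_def)

text \<open>Moving in the direction of \<open>e\<close> never enters the removed half of \<open>Z\<close>, by invariance. So every point can be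
  lifted into the open half-space of positive \<open>e\<close>-coordinate, which is convex and misses
  the removed half.\<close>

lemma contractible_off_half:
  assumes inv: "invariant_along {e} Z" and "e \<noteq> 0"
  shows "contractible (off_half Z e)"
proof -
  have ee: "0 < e \<bullet> e"
    using \<open>e \<noteq> 0\<close> by simp
  define lift where "lift x = x + ((1 + \<bar>e \<bullet> x\<bar>) / (e \<bullet> e)) *\<^sub>R e" for x
  have pos: "0 < e \<bullet> lift x" for x
    using ee by (simp add: lift_def inner_add_right)
  have half: "{x. 0 < e \<bullet> x} \<subseteq> off_half Z e"
    by (auto simp: off_half_def)
  have cont: "continuous_on (off_half Z e) lift"
    unfolding lift_def using ee by (intro continuous_intros) auto
  have up: "x + t *\<^sub>R e \<in> off_half Z e" if "x \<in> off_half Z e" "0 \<le> t" for x t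
  proof (rule ccontr)
    assume "x + t *\<^sub>R e \<notin> off_half Z e"
    then have z: "x + t *\<^sub>R e \<in> Z" and le: "e \<bullet> x + t * (e \<bullet> e) \<le> 0"
      by (auto simp: off_half_def inner_add_right)
    have "x + t *\<^sub>R e + (- t) *\<^sub>R e \<in> Z"
      using inv z unfolding invariant_along_def by blast
    moreover have "e \<bullet> x \<le> 0"
      using le ee \<open>0 \<le> t\<close> mult_nonneg_nonneg [of t "e \<bullet> e"] by linarith
    ultimately show False
      using that(1) by (simp add: off_half_def)
  qed
  have "homotopic_with_canon (\<lambda>x. True) (off_half Z e) (off_half Z e) id lift"
  proof (rule homotopic_with_linear)
    fix x assume x: "x \<in> off_half Z e"
    show "closed_segment (id x) (lift x) \<subseteq> off_half Z e"
    proof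
      fix y assume "y \<in> closed_segment (id x) (lift x)"
      then obtain s where s: "0 \<le> s" "s \<le> 1" "y = (1 - s) *\<^sub>R x + s *\<^sub>R lift x"
        by (auto simp: in_segment)
      then have "y = x + (s * ((1 + \<bar>e \<bullet> x\<bar>) / (e \<bullet> e))) *\<^sub>R e"
        by (simp add: lift_def algebra_simps)
      then show "y \<in> off_half Z e"
        using up [OF x] s ee by simp
    qed
  qed (use cont in \<open>auto simp: continuous_on_id\<close>)
  moreover have "homotopic_with_canon (\<lambda>x. True) (off_half Z e) (off_half Z e) lift (\<lambda>x. e)"
  proof (rule homotopic_with_linear)
    fix x
    have "closed_segment (lift x) e \<subseteq> {x. 0 < e \<bullet> x}"
      using pos ee by (intro closed_segment_subset convex_halfspace_gt [of 0 e]) auto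
    then show "closed_segment (lift x) e \<subseteq> off_half Z e"
      using half by blast
  qed (use cont in auto)
  ultimately show ?thesis
    unfolding contractible_def using homotopic_with_trans by blast
qed

text \<open>The class \<open>c'\<close> is chosen before \<open>Z\<close>: the point is that a single class detects vanishing for all \<open>Z\<close>
  simultaneously. This is what naturality of the Mayer-Vietoris isomorphism provides.\<close>

lemma suspension_step:
  assumes "closed A" "- A \<noteq> {}" "invariant_along {e} A" "e \<noteq> 0"
    and c: "c \<in> carrier (reduced_homology_group q (top_of_set (- A)))"
  obtains c' where
    "c' \<in> carrier (reduced_homology_group (q + 1) (top_of_set (- (A \<inter> {x. e \<bullet> x = 0}))))"
    "\<And>Z. \<lbrakk>closed Z; Z \<subseteq> A; invariant_along {e} Z\<rbrakk> \<Longrightarrow>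
       vanishes_in q (- A) (- Z) c \<longleftrightarrow>
       vanishes_in (q + 1) (- (A \<inter> {x. e \<bullet> x = 0})) (- (Z \<inter> {x. e \<bullet> x = 0})) c'"
proof -
  have cover: "open (off_half Z e)" "open (off_half Z (- e))"
      "contractible (off_half Z e)" "contractible (off_half Z (- e))" "off_half Z e \<inter> off_half Z (- e) \<noteq> {}"
    if "closed Z" "Z \<subseteq> A" "invariant_along {e} Z" for Z
  proof -
    have "z + (- t) *\<^sub>R e \<in> Z" if "z \<in> Z" for z t
      using that \<open>invariant_along {e} Z\<close> unfolding invariant_along_def by blast
    then have "invariant_along {- e} Z"
      by (auto simp: invariant_along_def)
    then show "contractible (off_half Z (- e))"
      using \<open>e \<noteq> 0\<close> by (intro contractible_off_half) auto
    show "off_half Z e \<inter> off_half Z (- e) \<noteq> {}"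
      using \<open>- A \<noteq> {}\<close> \<open>Z \<subseteq> A\<close> unfolding off_half_Int by auto
  qed (use that assms in \<open>auto intro: open_off_half contractible_off_half\<close>)
  obtain c' where c': "mv_related q (off_half A e) (off_half A (- e)) c c'"
    using mv_related_exists [OF cover [OF assms(1) order_refl assms(3)], of c q] c
    unfolding off_half_Int by blast
  show ?thesis
  proof
    show "c' \<in> carrier (reduced_homology_group (q + 1) (top_of_set (- (A \<inter> {x. e \<bullet> x = 0}))))"
      using c' unfolding mv_related_def off_half_Un by blast
  next
    fix Z assume Z: "closed Z" "Z \<subseteq> A" "invariant_along {e} Z"
    show "vanishes_in q (- A) (- Z) c \<longleftrightarrow>
       vanishes_in (q + 1) (- (A \<inter> {x. e \<bullet> x = 0})) (- (Z \<inter> {x. e \<bullet> x = 0})) c'"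
      using mv_related_eq_one_iff [OF cover [OF Z]
          mv_related_mono [OF c' off_half_antimono [OF Z(2)] off_half_antimono [OF Z(2)]]]
      unfolding off_half_Int off_half_Un .
  qed
qed

definition perp :: "'a::euclidean_space set \<Rightarrow> 'a set" where
  "perp B = {x. \<forall>b\<in>B. b \<bullet> x = 0}"

text \<open>Slicing by one hyperplane keeps the invariance along the remaining, orthogonal directions, so the
  suspension step can be repeated inside the same ambient space.\<close>

lemma iterated_suspension:
  fixes B :: "'a::euclidean_space set"
  assumes "finite B" "pairwise orthogonal B" "0 \<notin> B"
    and "closed A" "- A \<noteq> {}" "invariant_along B A"
    and "c \<in> carrier (reduced_homology_group q (top_of_set (- A)))"
  shows "\<exists>p c'. \<forall>Z. closed Z \<and> Z \<subseteq> A \<and> invariant_along B Z \<longrightarrow>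
       (vanishes_in q (- A) (- Z) c \<longleftrightarrow> vanishes_in p (- (A \<inter> perp B)) (- (Z \<inter> perp B)) c')"
  using assms
proof (induction B arbitrary: A c q)
  case empty
  then show ?case
    by (intro exI [of _ q] exI [of _ c]) (simp add: perp_def)
next
  case (insert b B)
  let ?H = "{x. b \<bullet> x = 0}"
  have inv_b: "invariant_along {b} Z" if "invariant_along (insert b B) Z" for Z
    using that by (simp add: invariant_along_def)
  have inv_B: "invariant_along B (Z \<inter> ?H)" if "invariant_along (insert b B) Z" for Z
    using that insert.prems(1) insert.hyps(2)
    by (auto simp: invariant_along_def pairwise_insert orthogonal_def inner_add_right)
  have clo: "closed (Z \<inter> ?H)" if "closed Z" for Z
    using that by (intro closed_Int closed_hyperplane)
  have perp: "Z \<inter> ?H \<inter> perp B = Z \<inter> perp (insert b B)" for Z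
    by (auto simp: perp_def)
  obtain c1 where c1: "c1 \<in> carrier (reduced_homology_group (q + 1) (top_of_set (- (A \<inter> ?H))))"
    and step: "\<And>Z. \<lbrakk>closed Z; Z \<subseteq> A; invariant_along {b} Z\<rbrakk> \<Longrightarrow>
       vanishes_in q (- A) (- Z) c \<longleftrightarrow> vanishes_in (q + 1) (- (A \<inter> ?H)) (- (Z \<inter> ?H)) c1"
    using suspension_step [OF insert.prems(3,4) inv_b [OF insert.prems(5)] _ insert.prems(6)]
      insert.prems(2) by auto
  have "\<exists>p c'. \<forall>Z. closed Z \<and> Z \<subseteq> A \<inter> ?H \<and> invariant_along B Z \<longrightarrow>
       (vanishes_in (q + 1) (- (A \<inter> ?H)) (- Z) c1 \<longleftrightarrow>
        vanishes_in p (- (A \<inter> ?H \<inter> perp B)) (- (Z \<inter> perp B)) c')"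
    using insert.prems c1 by (intro insert.IH inv_B clo) (auto simp: pairwise_insert)
  then obtain p c' where c': "\<forall>Z. closed Z \<and> Z \<subseteq> A \<inter> ?H \<and> invariant_along B Z \<longrightarrow>
       (vanishes_in (q + 1) (- (A \<inter> ?H)) (- Z) c1 \<longleftrightarrow>
        vanishes_in p (- (A \<inter> ?H \<inter> perp B)) (- (Z \<inter> perp B)) c')"
    by (elim exE) (rule that)
  show ?case
  proof (intro exI allI impI)
    fix Z assume "closed Z \<and> Z \<subseteq> A \<and> invariant_along (insert b B) Z"
    then have Z: "closed Z" "Z \<subseteq> A" "invariant_along (insert b B) Z"
      by auto
    have "closed (Z \<inter> ?H) \<and> Z \<inter> ?H \<subseteq> A \<inter> ?H \<and> invariant_along B (Z \<inter> ?H)"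
      using Z clo inv_B by blast
    from step [OF Z(1,2) inv_b [OF Z(3)]] c' [rule_format, OF this]
    show "vanishes_in q (- A) (- Z) c \<longleftrightarrow>
        vanishes_in p (- (A \<inter> perp (insert b B))) (- (Z \<inter> perp (insert b B))) c'"
      unfolding perp by (rule trans)
  qed
qed

text \<open>The complement of \<open>Z \<times> UNIV\<close> is the complement of \<open>Z\<close> times a vector space, so \<open>c\<close> may be moved there along
  the zero section; suspending along a basis of the second factor then cuts \<open>Z \<times> UNIV\<close> down to
  \<open>Z \<times> {0}\<close>.\<close>

lemma suspension_to_product:
  fixes A :: "'a::euclidean_space set"
  assumes "closed A" "- A \<noteq> {}"
    and c: "c \<in> carrier (reduced_homology_group q (top_of_set (- A)))"
  obtains p c' where "\<And>Z. \<lbrakk>closed Z; Z \<subseteq> A\<rbrakk> \<Longrightarrow>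
     vanishes_in q (- A) (- Z) c \<longleftrightarrow>
     vanishes_in p (- (A \<times> {0 :: 'a})) (- (Z \<times> {0 :: 'a})) c'"
proof -
  let ?U = "UNIV :: 'a set"
  let ?s = "\<lambda>y::'a. (y, 0::'a)"
  define B where "B = Pair (0::'a) ` (Basis :: 'a set)"
  define c1 where "c1 = push q (- A) (- (A \<times> ?U)) ?s c"
  have conts: "continuous_on X ?s" for X
    by (intro continuous_intros)
  have contf: "continuous_on X fst" for X :: "('a \<times> 'a) set"
    by (intro continuous_intros)
  \<comment> \<open>The zero section is natural in the removed set and has the left inverse \<open>fst\<close>, so it is
    injective on homology.\<close>
  have stab: "vanishes_in q (- A) (- Z) c \<longleftrightarrow> vanishes_in q (- (A \<times> ?U)) (- (Z \<times> ?U)) c1"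
    if "Z \<subseteq> A" for Z
  proof -
    have "push q (- (A \<times> ?U)) (- (Z \<times> ?U)) id c1 = push q (- A) (- (Z \<times> ?U)) (id \<circ> ?s) c"
      unfolding c1_def using that by (intro push_push conts) (auto simp: continuous_on_id)
    also have "\<dots> = push q (- Z) (- (Z \<times> ?U)) ?s (push q (- A) (- Z) id c)"
      using that by (subst push_push) (auto simp: conts continuous_on_id o_def)
    finally have eq: "push q (- (A \<times> ?U)) (- (Z \<times> ?U)) id c1 = \<dots>" .
    have "push q (- (Z \<times> ?U)) (- Z) fst (push q (- Z) (- (Z \<times> ?U)) ?s x)
        = push q (- Z) (- Z) (fst \<circ> ?s) x" for x
      by (intro push_push conts contf) auto
    moreover have "fst \<circ> ?s = id"
      by auto
    ultimately have "push q (- (Z \<times> ?U)) (- Z) fst (push q (- (A \<times> ?U)) (- (Z \<times> ?U)) id c1)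
        = push q (- A) (- Z) id c"
      unfolding eq by (simp add: hom_induced_id [OF hom_induced_carrier])
    then show ?thesis
      using eq push_one by metis
  qed
  have "\<exists>p c'. \<forall>Z. closed Z \<and> Z \<subseteq> A \<times> ?U \<and> invariant_along B Z \<longrightarrow>
       (vanishes_in q (- (A \<times> ?U)) (- Z) c1 \<longleftrightarrow>
        vanishes_in p (- (A \<times> ?U \<inter> perp B)) (- (Z \<inter> perp B)) c')"
  proof (rule iterated_suspension)
    show "pairwise orthogonal B"
      by (auto simp: B_def pairwise_def orthogonal_def inner_not_same_Basis)
    show "0 \<notin> B"
      by (auto simp: B_def zero_prod_def)
    show "c1 \<in> carrier (reduced_homology_group q (top_of_set (- (A \<times> ?U))))"
      unfolding c1_def by (rule hom_induced_reduced [OF c])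
  qed (use assms in \<open>auto simp: B_def invariant_along_def closed_Times\<close>)
  then obtain p c' where c': "\<forall>Z. closed Z \<and> Z \<subseteq> A \<times> ?U \<and> invariant_along B Z \<longrightarrow>
       (vanishes_in q (- (A \<times> ?U)) (- Z) c1 \<longleftrightarrow>
        vanishes_in p (- (A \<times> ?U \<inter> perp B)) (- (Z \<inter> perp B)) c')"
    by (elim exE) (rule that)
  have perp: "Z \<times> ?U \<inter> perp B = Z \<times> {0}" for Z :: "'a set"
    by (auto simp: perp_def B_def euclidean_all_zero_iff inner_commute)
  show ?thesis
  proof
    fix Z assume Z: "closed Z" "Z \<subseteq> A"
    have "closed (Z \<times> ?U) \<and> Z \<times> ?U \<subseteq> A \<times> ?U \<and> invariant_along B (Z \<times> ?U)"
      using Z by (auto simp: invariant_along_def B_def closed_Times)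
    from stab [OF Z(2)] c' [rule_format, OF this]
    show "vanishes_in q (- A) (- Z) c \<longleftrightarrow>
     vanishes_in p (- (A \<times> {0 :: 'a})) (- (Z \<times> {0 :: 'a})) c'"
      unfolding perp by (rule trans)
  qed
qed

section \<open>A map between complements in the doubled space\<close>

text \<open>Over \<open>X\<close> a nonzero vector \<open>u\<close> is lengthened by exactly \<open>R\<close>. The distance to \<open>X\<close> in the denominator makes
  this continuous at the points \<open>(y, 0)\<close> with \<open>y \<notin> X\<close>.\<close>

definition stretch :: "real \<Rightarrow> 'a::euclidean_space set \<Rightarrow> 'a \<times> 'a \<Rightarrow> 'a" where
  "stretch R X = (\<lambda>(y, u). (1 + R / (norm u + infdist y X)) *\<^sub>R u)"

lemma continuous_on_stretch:
  assumes "closed X" "X \<noteq> {}"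
  shows "continuous_on (- (X \<times> {0})) (stretch R X)"
proof -
  have "norm (snd w) + infdist (fst w) X \<noteq> 0" if "w \<in> - (X \<times> {0})" for w
  proof
    assume "norm (snd w) + infdist (fst w) X = 0"
    then have "norm (snd w) = 0" "infdist (fst w) X = 0"
      using infdist_nonneg [of "fst w" X] norm_ge_zero [of "snd w"] by linarith+
    then show False
      using that assms in_closed_iff_infdist_zero [of X "fst w"] by (auto simp: mem_Times_iff)
  qed
  then show ?thesis
    unfolding stretch_def case_prod_unfold by (intro continuous_intros) blast+
qed

lemma norm_stretch:
  assumes "y \<in> X" "u \<noteq> 0" "0 \<le> R"
  shows "stretch R X (y, u) = (1 + R / norm u) *\<^sub>R u" "norm (stretch R X (y, u)) = norm u + R"
proof -
  show *: "stretch R X (y, u) = (1 + R / norm u) *\<^sub>R u"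
    using assms by (simp add: stretch_def)
  have "0 \<le> R / norm u"
    using assms by simp
  then show "norm (stretch R X (y, u)) = norm u + R"
    unfolding * using assms by (simp add: field_simps)
qed

text \<open>With \<open>v\<close> the stretched vector, the inclusion is joined to
  \<open>(y, u) \<mapsto> (y + v, \<phi> (y + v) - y)\<close> in three steps, each moving \<open>v\<close> or the image along segments: exchange
  stretching over \<open>F\<close> for stretching over \<open>A\<close>; deform \<open>\<phi>\<close> to the identity, reaching \<open>(y + v, v)\<close>;
  shrink this to \<open>(y, u)\<close>. The exchange is needed because the deformed \<open>\<phi>\<close> maps \<open>E\<close> only
  into \<open>A\<close>, so that vectors over all of \<open>A\<close> have to be long, whereas stretching over \<open>A\<close> is not continuous at
  \<open>(y, 0)\<close> with \<open>y \<in> A - F\<close>, a point of the complement of \<open>F \<times> {0}\<close>.\<close>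

lemma vanishing_pulls_back_product:
  fixes \<phi> :: "'a::euclidean_space \<Rightarrow> 'a"
  assumes cont: "continuous_on UNIV \<phi>"
    and A: "closed A" and F: "closed F" "F \<subseteq> A" "F \<noteq> {}" and E: "E \<subseteq> A"
    and im: "\<phi> ` E \<subseteq> F"
    and seg: "\<And>x. x \<in> A \<Longrightarrow> closed_segment x (\<phi> x) \<subseteq> A"
    and near: "\<And>x. x \<in> A \<Longrightarrow> norm (\<phi> x - x) \<le> R"
    and van: "vanishes_in p (- (A \<times> {0 :: 'a})) (- (F \<times> {0 :: 'a})) c"
  shows "vanishes_in p (- (A \<times> {0 :: 'a})) (- (E \<times> {0 :: 'a})) c"
proof -
  have "A \<noteq> {}"
    using F by auto
  have "0 \<le> R"
    using near F norm_ge_zero order_trans by blast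
  let ?A = "- (A \<times> {0 :: 'a})" and ?F = "- (F \<times> {0 :: 'a})" and ?E = "- (E \<times> {0 :: 'a})"
  \<comment> \<open>The preimage of \<open>E \<times> {0}\<close> under \<open>\<Phi>\<close> below, which the stretched points have to avoid.\<close>
  define K where "K = {(y, v). y + v \<in> E \<and> \<phi> (y + v) = y}"
  define \<Phi> where "\<Phi> = (\<lambda>(y, v). (y + v, \<phi> (y + v) - y))"
  define stretched where "stretched X = (\<lambda>w. (fst w, stretch R X w))" for X :: "'a set"
  have incl: "?A \<subseteq> ?F" "?A \<subseteq> ?E"
    using F E by auto
  have cont\<Phi>: "continuous_on X \<Phi>" for X
    unfolding \<Phi>_def case_prod_unfold
    by (intro continuous_intros continuous_on_compose2 [OF cont]) auto
  have map\<Phi>: "\<Phi> \<in> - K \<rightarrow> ?E"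
    by (auto simp: \<Phi>_def K_def)
  have contA: "continuous_on ?A (stretched A)"
    unfolding stretched_def
    by (intro continuous_intros continuous_on_stretch A \<open>A \<noteq> {}\<close>)
  have contF: "continuous_on ?F (stretched F)"
    unfolding stretched_def by (intro continuous_intros continuous_on_stretch F)
  have K: "y \<in> F \<and> norm v \<le> R" if "(y, v) \<in> K" for y v
  proof -
    have v: "y + v \<in> E" "\<phi> (y + v) = y"
      using that by (auto simp: K_def)
    have "norm (\<phi> (y + v) - (y + v)) \<le> R"
      using near E v(1) by blast
    then show ?thesis
      using v im by auto
  qed
  have mapF: "stretched F \<in> ?F \<rightarrow> - K"
  proof (intro Pi_I ComplI)
    fix w assume "w \<in> ?F" "stretched F w \<in> K"
    obtain y u where w: "w = (y, u)"
      by force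
    have y: "y \<in> F" "norm (stretch R F (y, u)) \<le> R"
      using K [of y "stretch R F (y, u)"] \<open>stretched F w \<in> K\<close> by (auto simp: stretched_def w)
    then have "u \<noteq> 0"
      using \<open>w \<in> ?F\<close> w by auto
    then show False
      using y norm_stretch(2) [of y F u R] \<open>0 \<le> R\<close> by auto
  qed
  \<comment> \<open>\<open>K\<close> lies over \<open>F\<close>, and there both stretchings agree.\<close>
  have "homotopic_with_canon (\<lambda>x. True) ?A (- K) (stretched F) (stretched A)"
  proof (rule homotopic_with_linear)
    fix w assume "w \<in> ?A"
    obtain y u where w: "w = (y, u)"
      by force
    show "closed_segment (stretched F w) (stretched A w) \<subseteq> - K"
    proof
      fix z assume "z \<in> closed_segment (stretched F w) (stretched A w)"
      then obtain s where z: "z = (1 - s) *\<^sub>R stretched F w + s *\<^sub>R stretched A w"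
        by (auto simp: in_segment)
      show "z \<in> - K"
      proof
        assume "z \<in> K"
        have "fst z = y"
          by (simp add: z stretched_def w algebra_simps)
        then have y: "y \<in> F" "norm (snd z) \<le> R"
          using K [of "fst z" "snd z"] \<open>z \<in> K\<close> by auto
        then have "u \<noteq> 0" "y \<in> A"
          using \<open>w \<in> ?A\<close> w F by auto
        then have "stretch R F w = stretch R A w"
          using y(1) \<open>0 \<le> R\<close> by (simp add: w norm_stretch(1))
        then have "snd z = stretch R A w"
          by (simp add: z stretched_def flip: scaleR_add_left)
        then show False
          using y \<open>u \<noteq> 0\<close> \<open>y \<in> A\<close> \<open>0 \<le> R\<close> norm_stretch(2) [of y A u R] by (simp add: w)
      qed
    qed
  qed (use contA contF incl in \<open>auto intro: continuous_on_subset\<close>)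
  then have h1: "homotopic_with_canon (\<lambda>x. True) ?A ?E (\<Phi> \<circ> stretched F) (\<Phi> \<circ> stretched A)"
    by (rule homotopic_with_compose_continuous_left [where p = "\<lambda>_. True", OF _ cont\<Phi> map\<Phi>])
  define slide where "slide = (\<lambda>w. (fst w + stretch R A w, stretch R A w))"
  have contslide: "continuous_on ?A slide"
    unfolding slide_def
    by (intro continuous_intros continuous_on_stretch A \<open>A \<noteq> {}\<close>)
  \<comment> \<open>A zero of the second component would put \<open>y\<close> on the segment from \<open>x = y + v\<close> to \<open>\<phi> x\<close>. Hence
    \<open>y \<in> A\<close>, where \<open>v\<close> is longer than \<open>R\<close>, while that segment has length at most \<open>R\<close>.\<close>
  have h2: "homotopic_with_canon (\<lambda>x. True) ?A ?E (\<Phi> \<circ> stretched A) slide"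
  proof (rule homotopic_with_linear)
    fix w assume "w \<in> ?A"
    obtain y u where w: "w = (y, u)"
      by force
    let ?v = "stretch R A (y, u)"
    show "closed_segment ((\<Phi> \<circ> stretched A) w) (slide w) \<subseteq> ?E"
    proof
      fix z assume "z \<in> closed_segment ((\<Phi> \<circ> stretched A) w) (slide w)"
      then obtain s where s: "0 \<le> s" "s \<le> 1"
        and z: "z = (1 - s) *\<^sub>R \<Phi> (stretched A w) + s *\<^sub>R slide w"
        by (auto simp: in_segment)
      show "z \<in> ?E"
      proof
        assume "z \<in> E \<times> {0}"
        moreover have "fst z = y + ?v"
          by (simp add: z w \<Phi>_def stretched_def slide_def algebra_simps)
        ultimately have x: "y + ?v \<in> A" and "snd z = 0"
          using E by (auto simp: mem_Times_iff)
        then have eq: "(1 - s) *\<^sub>R (\<phi> (y + ?v) - y) + s *\<^sub>R ?v = 0"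
          by (simp add: z w \<Phi>_def stretched_def slide_def)
        then have y: "y = s *\<^sub>R (y + ?v) + (1 - s) *\<^sub>R \<phi> (y + ?v)"
          by (simp add: algebra_simps)
        then have "y \<in> closed_segment (y + ?v) (\<phi> (y + ?v))"
          using s by (auto simp: in_segment intro!: exI [of _ "1 - s"])
        then have "y \<in> A"
          using seg [OF x] by blast
        then have "u \<noteq> 0"
          using \<open>w \<in> ?A\<close> w by auto
        have "?v = (1 - s) *\<^sub>R (- (\<phi> (y + ?v) - (y + ?v)))"
          using eq by (simp add: algebra_simps)
        then have "norm ?v = (1 - s) * norm (\<phi> (y + ?v) - (y + ?v))"
          using s by (metis abs_of_nonneg diff_ge_0_iff_ge norm_minus_cancel norm_scaleR)
        also have "\<dots> \<le> 1 * R"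
          using s near [OF x] by (intro mult_mono) auto
        finally show False
          using norm_stretch(2) [OF \<open>y \<in> A\<close> \<open>u \<noteq> 0\<close> \<open>0 \<le> R\<close>] \<open>u \<noteq> 0\<close> by simp
      qed
    qed
  qed (intro continuous_on_compose contA cont\<Phi> contslide)+
  \<comment> \<open>The second component stays a positive multiple of \<open>u\<close>.\<close>
  have h3: "homotopic_with_canon (\<lambda>x. True) ?A ?E slide id"
  proof (rule homotopic_with_linear)
    fix w assume "w \<in> ?A"
    obtain y u where w: "w = (y, u)"
      by force
    show "closed_segment (slide w) (id w) \<subseteq> ?E"
    proof
      fix z assume "z \<in> closed_segment (slide w) (id w)"
      then obtain s where s: "0 \<le> s" "s \<le> 1" and z: "z = (1 - s) *\<^sub>R slide w + s *\<^sub>R w"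
        by (auto simp: in_segment)
      define \<mu> where "\<mu> = R / (norm u + infdist y A)"
      have "0 \<le> \<mu>"
        using \<open>0 \<le> R\<close> infdist_nonneg [of y A] by (simp add: \<mu>_def)
      have "snd z = (1 + (1 - s) * \<mu>) *\<^sub>R u"
        by (simp add: z w slide_def stretch_def \<mu>_def algebra_simps)
      moreover have "0 < 1 + (1 - s) * \<mu>"
        using s \<open>0 \<le> \<mu>\<close> by (simp add: add_pos_nonneg)
      ultimately have "snd z = 0 \<longleftrightarrow> u = 0"
        by auto
      moreover have "fst z = y" if "u = 0"
        using that by (simp add: z w slide_def stretch_def algebra_simps)
      ultimately show "z \<in> ?E"
        using \<open>w \<in> ?A\<close> w E by (auto simp: mem_Times_iff)
    qed
  qed (use contslide in \<open>auto simp: continuous_on_id\<close>)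
  have "homotopic_with_canon (\<lambda>x. True) ?A ?E id (\<Phi> \<circ> stretched F)"
    using h1 h2 h3 homotopic_with_trans homotopic_with_symD by blast
  then have "push p ?A ?E id = push p ?A ?E (\<Phi> \<circ> stretched F)"
    by (rule homology_homotopy_empty)
  then have "push p ?A ?E id c = push p ?A ?E ((\<Phi> \<circ> stretched F) \<circ> id) c"
    by simp
  also have "\<dots> = push p ?F ?E (\<Phi> \<circ> stretched F) (push p ?A ?F id c)"
  proof (rule push_push [symmetric])
    show "continuous_on ?F (\<Phi> \<circ> stretched F)"
      by (intro continuous_on_compose contF cont\<Phi>)
    show "\<Phi> \<circ> stretched F \<in> ?F \<rightarrow> ?E"
      unfolding o_def by (rule Pi_I) (rule Pi_mem [OF map\<Phi> Pi_mem [OF mapF]])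
  qed (use incl in \<open>auto simp: continuous_on_id\<close>)
  also have "\<dots> = \<one>\<^bsub>homology_group p (top_of_set ?E)\<^esub>"
    unfolding van by (rule push_one)
  finally show ?thesis .
qed

text \<open>The case \<open>F = {}\<close> is separate because there the distance to \<open>F\<close> cannot be used for stretching;
  then \<open>E\<close> is empty too.\<close>

lemma vanishing_pulls_back:
  fixes \<phi> :: "'a::euclidean_space \<Rightarrow> 'a"
  assumes cont: "continuous_on UNIV \<phi>"
    and "closed A" "closed E" "closed F" "E \<subseteq> A" "F \<subseteq> A" "\<phi> ` E \<subseteq> F"
    and seg: "\<And>x. x \<in> A \<Longrightarrow> closed_segment x (\<phi> x) \<subseteq> A"
    and near: "\<And>x. x \<in> A \<Longrightarrow> norm (\<phi> x - x) \<le> R"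
    and "- A \<noteq> {}"
    and c: "c \<in> carrier (reduced_homology_group q (top_of_set (- A)))"
    and van: "vanishes_in q (- A) (- F) c"
  shows "vanishes_in q (- A) (- E) c"
proof (cases "F = {}")
  case True
  then show ?thesis
    using van \<open>\<phi> ` E \<subseteq> F\<close> by simp
next
  case False
  obtain p c' where susp: "\<And>Z. \<lbrakk>closed Z; Z \<subseteq> A\<rbrakk> \<Longrightarrow>
     vanishes_in q (- A) (- Z) c \<longleftrightarrow>
     vanishes_in p (- (A \<times> {0 :: 'a})) (- (Z \<times> {0 :: 'a})) c'"
    using suspension_to_product [OF \<open>closed A\<close> \<open>- A \<noteq> {}\<close> c] by metis
  from iffD1 [OF susp [OF \<open>closed F\<close> \<open>F \<subseteq> A\<close>] van]
  have "vanishes_in p (- (A \<times> {0 :: 'a})) (- (E \<times> {0 :: 'a})) c'"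
    by (intro vanishing_pulls_back_product [OF cont \<open>closed A\<close> \<open>closed F\<close> \<open>F \<subseteq> A\<close> False
          \<open>E \<subseteq> A\<close> \<open>\<phi> ` E \<subseteq> F\<close> seg near])
  then show ?thesis
    by (rule iffD2 [OF susp [OF \<open>closed E\<close> \<open>E \<subseteq> A\<close>]])
qed

section \<open>Fundamental cycles of spheres\<close>

lemma fundamental_cycle_relcycle:
  assumes "fundamental_cycle k S z"
  shows "singular_relcycle k (top_of_set S) {} z"
proof (cases "k = 0")
  case True
  have "singular_simplex 0 (top_of_set S) (\<lambda>t\<in>standard_simplex 0. a)" if "a \<in> S" for a
    using that by (auto simp: singular_simplex_def)
  then have "singular_chain 0 (top_of_set S) (point_chain a)" if "a \<in> S" for a
    using that by (simp add: point_chain_def singular_chain_of)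
  then show ?thesis
    using assms True by (auto simp: fundamental_cycle_def singular_cycle chain_boundary_def singular_chain_diff)
next
  case False
  then show ?thesis
    using assms by (simp add: fundamental_cycle_def)
qed

text \<open>Only degree \<open>0\<close> has content: there the cycle is a difference of two points, which
  become equal in a one-point space.\<close>

lemma fundamental_cycle_reduced:
  assumes "fundamental_cycle k S z" "S \<subseteq> X"
  shows "homologous_rel_set k (top_of_set X) {} z \<in> carrier (reduced_homology_group (int k) (top_of_set X))"
proof -
  have cyc: "singular_relcycle k (top_of_set X) {} z"
    using fundamental_cycle_relcycle [OF assms(1)] assms(2)
    by (metis singular_cycle_mono subtopology_UNIV inf_top_left subset_UNIV)
  then have car: "homologous_rel_set k (top_of_set X) {} z \<in> carrier (homology_group (int k) (top_of_set X))"
    by (auto simp: carrier_relative_homology_group)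
  show ?thesis
  proof (cases "k = 0")
    case False
    then show ?thesis
      using car by (simp add: un_reduced_homology_group)
  next
    case True
    then obtain a b where z: "z = point_chain b - point_chain a"
      using assms(1) by (auto simp: fundamental_cycle_def)
    have "simplex_map 0 (\<lambda>x. ()) g = simplex_map 0 (\<lambda>x. ()) h" for g h :: "(nat \<Rightarrow> real) \<Rightarrow> 'a"
      by (auto simp: simplex_map_def)
    then have "chain_map 0 (\<lambda>x. ()) z = 0"
      unfolding z point_chain_def chain_map_diff chain_map_of by (metis diff_self)
    then have "hom_induced 0 (top_of_set X) {} (discrete_topology {()}) {} (\<lambda>x. ())
        (homologous_rel_set 0 (top_of_set X) {} z) = homologous_rel_set 0 (discrete_topology {()}) {} 0"
      using hom_induced_chain_map [of "top_of_set X" "discrete_topology {()}" "\<lambda>x. ()" "{}" "{}" 0 z]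
        cyc True by simp
    also have "\<dots> = \<one>\<^bsub>homology_group 0 (discrete_topology {()})\<^esub>"
      using one_relative_homology_group [of 0 "discrete_topology {()}" "{}"]
      by (simp add: homologous_rel_set_eq_relboundary)
    finally show ?thesis
      using car True by (simp add: carrier_reduced_homology_group kernel_def)
  qed
qed

lemma push_homologous_rel_set:
  assumes "singular_relcycle k (top_of_set X) {} z" "X \<subseteq> Y"
  shows "push (int k) X Y id (homologous_rel_set k (top_of_set X) {} z) = homologous_rel_set k (top_of_set Y) {} z"
proof -
  have "chain_map k id z = z"
    using assms(1) chain_map_id_gen singular_relcycle_def by (metis id_apply)
  then show ?thesis
    using hom_induced_chain_map [of "top_of_set X" "top_of_set Y" id "{}" "{}" k z] assms
    by (simp add: image_subset_iff_funcset [symmetric])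
qed

section \<open>Almgren competitors\<close>

theorem proposition3p7:
  fixes E F :: "(real ^ 'n) set" and d :: nat
  assumes "closed E"
    and "almgren_competitor E F"
    and "0 < d" and "d < CARD('n)"
  shows "topological_competitor d E F"
proof -
  obtain \<phi> L c r where "closed F" and F: "F = \<phi> ` E" and lip: "L-lipschitz_on UNIV \<phi>"
    and "0 < r" and out: "\<And>x. x \<notin> cball c r \<Longrightarrow> \<phi> x = x" and inn: "\<phi> ` cball c r \<subseteq> cball c r"
    using assms(2) unfolding almgren_competitor_def by blast
  define A where "A = cball c r \<union> E"
  have "closed A" "E \<subseteq> A"
    using \<open>closed E\<close> by (auto simp: A_def)
  have FE: "F - cball c r = E - cball c r"
  proof -
    have "\<phi> e = e" if "\<phi> e \<notin> cball c r" for e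
      using that out inn by blast
    then show ?thesis
      unfolding F using out by (auto simp: image_iff) metis+
  qed
  have "F \<subseteq> A"
    using FE by (auto simp: A_def)
  have seg: "closed_segment x (\<phi> x) \<subseteq> A" if "x \<in> A" for x
  proof (cases "x \<in> cball c r")
    case True
    then have "closed_segment x (\<phi> x) \<subseteq> cball c r"
      using inn by (intro closed_segment_subset) blast+
    then show ?thesis
      by (auto simp: A_def)
  next
    case False
    then show ?thesis
      using out that by simp
  qed
  have near: "norm (\<phi> x - x) \<le> 2 * r" for x
  proof (cases "x \<in> cball c r")
    case True
    then have "\<phi> x \<in> cball c r"
      using inn by blast
    then show ?thesis
      using True dist_triangle [of "\<phi> x" x c] by (simp add: dist_norm dist_commute norm_minus_commute)
  next
    case False
    then show ?thesis
      using out \<open>0 < r\<close> by simp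
  qed
  have "represents_nonzero k S (- F)" if S: "S \<subseteq> - A" and nz: "represents_nonzero k S (- E)" for k S
  proof (rule ccontr)
    assume F0: "\<not> represents_nonzero k S (- F)"
    obtain z where z: "fundamental_cycle k S z"
      and E1: "homologous_rel_set k (top_of_set (- E)) {} z \<noteq> \<one>\<^bsub>homology_group (int k) (top_of_set (- E))\<^esub>"
      using nz unfolding represents_nonzero_def by blast
    have zA: "singular_relcycle k (top_of_set (- A)) {} z"
      using fundamental_cycle_relcycle [OF z] S
      by (metis singular_cycle_mono subtopology_UNIV inf_top_left subset_UNIV)
    let ?c = "homologous_rel_set k (top_of_set (- A)) {} z"
    have pE: "push (int k) (- A) (- E) id ?c = homologous_rel_set k (top_of_set (- E)) {} z"
      using zA by (intro push_homologous_rel_set) (auto simp: A_def)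
    have pF: "push (int k) (- A) (- F) id ?c = homologous_rel_set k (top_of_set (- F)) {} z"
      using zA \<open>F \<subseteq> A\<close> by (intro push_homologous_rel_set) auto
    \<comment> \<open>The Mayer-Vietoris argument needs a nonempty complement; otherwise the cycle is zero.\<close>
    have "- A \<noteq> {}"
    proof
      assume "- A = {}"
      then have "z = 0"
        using zA by (simp add: singular_cycle singular_chain_empty)
      then show False
        using E1 by (simp add: homologous_rel_set_eq_relboundary)
    qed
    moreover have "vanishes_in (int k) (- A) (- F) ?c"
      unfolding pF
    proof (rule ccontr)
      assume "homologous_rel_set k (top_of_set (- F)) {} z \<noteq> \<one>\<^bsub>homology_group (int k) (top_of_set (- F))\<^esub>"
      with z F0 show False
        unfolding represents_nonzero_def by (metis (no_types))
    qed
    ultimately have "vanishes_in (int k) (- A) (- E) ?c"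
      using near fundamental_cycle_reduced [OF z S]
      by (intro vanishing_pulls_back [OF lipschitz_on_continuous_on [OF lip] \<open>closed A\<close> \<open>closed E\<close>
            \<open>closed F\<close> \<open>E \<subseteq> A\<close> \<open>F \<subseteq> A\<close> _ seg near]) (use F in auto)
    with E1 show False
      unfolding pE by (rule notE)
  qed
  then show ?thesis
    unfolding topological_competitor_def A_def
    using \<open>closed E\<close> \<open>closed F\<close> \<open>0 < r\<close> FE by blast
qed

end
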